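(* Let $k$ be a positive integer. Let $G=(V,E,\partial)$ be a finite undirected graph with $V$ the disjoint union of $\{v_1,v_2,v_3,v_4\}$ (four distinct vertices) and a (possibly empty) set $Y$, such that every vertex $y\in Y$ has even degree in $G$. If after the deletion of any $k-1$ or fewer edges from $G$ there still exists a chain of edges $p$ with $\partial(p)=v_1+v_2+v_3+v_4$, then there exist $k$ chains of edges $p_1,\ldots,p_k$ in $G$, no two of which have a common nontrivial summand, such that $\partial(p_1)=\cdots=\partial(p_k)=v_1+v_2+v_3+v_4$.
   Context: A graph $G=(V,E,\partial)$ consists of a finite nonempty vertex set $V$, a finite edge set $E$, and a map $\partial$ assigning to each edge a set of exactly two distinct vertices (parallel edges allowed, no loops). The degree of a vertex $v$ is the number of edges $e$ with $v\in\partial(e)$. $A(S)$ is the $\mathbb{F}_2$-vector space of formal $\mathbb{F}_2$-linear combinations of elements of $S$; elements of $A(E)$ are chains of edges, with summands the edges of coefficient $1$. Two chains have no common nontrivial summand if no edge is a summand of both. $\partial$ extends $\mathbb{F}_2$-linearly to $A(E)\to A(V)$, sending an edge to the sum of its two endpoints. Deleting edges means removing them from $E$ (the vertex set is unchanged). *)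

theory Defs
  imports "HOL-Library.Poly_Mapping" "HOL-Library.Z2"
begin

record ('v, 'e) multigraph =
  verts :: "'v set"
  edges :: "'e set"
  ends :: "'e \<Rightarrow> 'v set"

text \<open>The function \<open>ends G\<close> is total on the edge type; only its values on \<open>edges G\<close> matter.\<close>

locale finite_multigraph =
  fixes G :: "('v, 'e) multigraph"
  assumes finite_verts: "finite (verts G)"
    and verts_nonempty: "verts G \<noteq> {}"
    and finite_edges: "finite (edges G)"
    and ends_subset: "e \<in> edges G \<Longrightarrow> ends G e \<subseteq> verts G"
    and card_ends: "e \<in> edges G \<Longrightarrow> card (ends G e) = 2"

definition vertex_degree :: "('v, 'e) multigraph \<Rightarrow> 'v \<Rightarrow> nat" where
  "vertex_degree G v = card {e \<in> edges G. v \<in> ends G e}"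

definition delete_edges :: "('v, 'e) multigraph \<Rightarrow> 'e set \<Rightarrow> ('v, 'e) multigraph" where
  "delete_edges G F = G\<lparr>edges := edges G - F\<rparr>"

text \<open>
  The type \<open>bit\<close> is the field with two elements. The vector space \<open>A(S)\<close> of formal linear
  combinations of elements of \<open>S\<close> is the set of finitely supported functions into \<open>bit\<close> whose
  support lies in \<open>S\<close>; the summands of a chain are the elements of its support.
\<close>

definition formal_sums :: "'a set \<Rightarrow> ('a \<Rightarrow>\<^sub>0 bit) set" where
  "formal_sums S = {c. Poly_Mapping.keys c \<subseteq> S}"

abbreviation generator :: "'a \<Rightarrow> ('a \<Rightarrow>\<^sub>0 bit)" where
  "generator x \<equiv> Poly_Mapping.single x 1"

definition no_common_summand :: "('a \<Rightarrow>\<^sub>0 bit) \<Rightarrow> ('a \<Rightarrow>\<^sub>0 bit) \<Rightarrow> bool" where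
  "no_common_summand c d \<longleftrightarrow> Poly_Mapping.keys c \<inter> Poly_Mapping.keys d = {}"

text \<open>
  The linear extension of the map sending an edge to the sum of its endpoints: over the field with
  two elements every edge in the support has coefficient \<open>1\<close>, so no scalar appears. Additivity is
  proved below.
\<close>

definition boundary :: "('v, 'e) multigraph \<Rightarrow> ('e \<Rightarrow>\<^sub>0 bit) \<Rightarrow> ('v \<Rightarrow>\<^sub>0 bit)" where
  "boundary G p = (\<Sum>e\<in>Poly_Mapping.keys p. \<Sum>v\<in>ends G e. generator v)"

lemma boundary_generator: "boundary G (generator e) = (\<Sum>v\<in>ends G e. generator v)"
  by (simp add: boundary_def)

lemma formal_sum_double [simp]: "(c :: 'a \<Rightarrow>\<^sub>0 bit) + c = 0"
  by (rule poly_mapping_eqI) (simp add: lookup_add)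

lemma boundary_add: "boundary G (p + q) = boundary G p + boundary G q"
proof -
  let ?b = "\<lambda>e. \<Sum>v\<in>ends G e. generator v"
  let ?P = "Poly_Mapping.keys p" and ?Q = "Poly_Mapping.keys q"
  have keys: "Poly_Mapping.keys (p + q) = (?P - ?Q) \<union> (?Q - ?P)"
  proof (rule set_eqI)
    fix e
    show "e \<in> Poly_Mapping.keys (p + q) \<longleftrightarrow> e \<in> (?P - ?Q) \<union> (?Q - ?P)"
      by (cases "Poly_Mapping.lookup p e"; cases "Poly_Mapping.lookup q e") (simp_all add: in_keys_iff lookup_add)
  qed
  have "sum ?b ?P = sum ?b (?P - ?Q) + sum ?b (?P \<inter> ?Q)"
    by (metis add.commute finite_keys sum.Int_Diff)
  moreover have "sum ?b ?Q = sum ?b (?Q - ?P) + sum ?b (?P \<inter> ?Q)"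
    by (metis add.commute finite_keys inf_commute sum.Int_Diff)
  ultimately have "boundary G p + boundary G q
      = sum ?b (?P - ?Q) + sum ?b (?Q - ?P) + (sum ?b (?P \<inter> ?Q) + sum ?b (?P \<inter> ?Q))"
    by (simp only: boundary_def ac_simps)
  also have "\<dots> = sum ?b (?P - ?Q) + sum ?b (?Q - ?P)"
    by (simp only: formal_sum_double add_0_right)
  also have "\<dots> = boundary G (p + q)"
    unfolding boundary_def keys by (subst sum.union_disjoint) auto
  finally show ?thesis ..
qed

end

theory Submission imports Defs "HOL-Library.Disjoint_Sets" begin

text \<open>
  Write \<open>T = {v1, v2, v3, v4}\<close>. A chain with boundary \<open>T\<close> is an edge set \<open>J\<close> whose odd-degree vertices
  are those of \<open>T\<close>, and the hypothesis says that every vertex set meeting \<open>T\<close> in a single vertex is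
  left by at least \<open>k\<close> edges. As long as some vertex outside \<open>T\<close> has an edge, two of its edges can be
  split off, as in the theorem of Lovasz and Cherkassky on packing \<open>T\<close>-paths, without destroying this
  cut condition: by parity the tight sets are minimum cuts, so they can be uncrossed. Packings lift
  back along the splitting. Once all edges lie within the four vertices of \<open>T\<close>, remove a
  perfect matching if there is one; otherwise the edges form a star with multiplicities, and one
  removes a simple star. Either way the degree bound drops by only one, and induction on \<open>k\<close> applies.
\<close>

section \<open>Cuts and joins\<close>

text \<open>For edges with two ends or none this is the usual edge boundary of \<open>U\<close>.
  Counting ends by parity makes it additive under symmetric differences of ends, as merging edges
  requires.\<close>

definition odd_cut :: "'e set \<Rightarrow> ('e \<Rightarrow> 'v set) \<Rightarrow> 'v set \<Rightarrow> 'e set" where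
  "odd_cut E h U = {e \<in> E. odd (card (h e \<inter> U))}"

text \<open>These are the T-joins of matching theory, the supports of chains whose boundary is the
  sum of \<open>T\<close>.\<close>

definition tjoin :: "('e \<Rightarrow> 'v set) \<Rightarrow> 'v set \<Rightarrow> 'e set \<Rightarrow> bool" where
  "tjoin h T J \<longleftrightarrow> (\<forall>v. odd (card (odd_cut J h {v})) \<longleftrightarrow> v \<in> T)"

lemma finite_cut [simp]: "finite E \<Longrightarrow> finite (odd_cut E h U)"
  by (simp add: odd_cut_def)

lemma cut_singleton: "odd_cut E h {v} = {e \<in> E. v \<in> h e}"
proof -
  have "odd (card (h e \<inter> {v})) \<longleftrightarrow> v \<in> h e" for e
    by (cases "v \<in> h e") auto
  then show ?thesis
    by (auto simp: odd_cut_def)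
qed

lemma card_cut: "finite E \<Longrightarrow> card (odd_cut E h U) = (\<Sum>e\<in>E. of_bool (odd (card (h e \<inter> U))))"
  by (simp add: odd_cut_def of_bool_def sum.If_cases Int_def)

lemma odd_card_pair_Int: "a \<noteq> b \<Longrightarrow> odd (card ({a, b} \<inter> U)) \<longleftrightarrow> (a \<in> U) \<noteq> (b \<in> U)"
  by (cases "a \<in> U"; cases "b \<in> U") auto

text \<open>Double counting of the incidences between \<open>U\<close> and \<open>E\<close>: an edge
  contributes oddly exactly when it lies in the cut.\<close>

lemma even_card_cut_iff:
  assumes "finite E" "finite U"
  shows "even (card (odd_cut E h U)) \<longleftrightarrow> even (\<Sum>v\<in>U. card (odd_cut E h {v}))"
proof -
  have "(\<Sum>v\<in>U. card (odd_cut E h {v})) = (\<Sum>v\<in>U. \<Sum>e\<in>E. of_bool (v \<in> h e))"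
    using assms by (simp add: cut_singleton of_bool_def sum.If_cases Int_def)
  also have "\<dots> = (\<Sum>e\<in>E. \<Sum>v\<in>U. of_bool (v \<in> h e))"
    by (rule sum.swap)
  also have "\<dots> = (\<Sum>e\<in>E. card (h e \<inter> U))"
    using assms by (simp add: of_bool_def sum.If_cases Int_commute Int_def conj_commute)
  finally show ?thesis
    using assms by (simp add: even_sum_iff odd_cut_def)
qed

text \<open>Within \<open>U\<close> only \<open>t\<close> has odd degree in \<open>J\<close>, so the
  cut has odd size. This turns the hypothesis on chains into a condition on cuts.\<close>

lemma tjoin_cut_nonempty:
  assumes "tjoin h T J" "finite J" "finite U" "U \<inter> T = {t}"
  shows "odd_cut J h U \<noteq> {}"
proof -
  have "(\<Sum>v\<in>U. card (odd_cut J h {v})) = card (odd_cut J h {t}) + (\<Sum>v\<in>U - {t}. card (odd_cut J h {v}))"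
    using assms by (intro sum.remove) auto
  moreover have "even (\<Sum>v\<in>U - {t}. card (odd_cut J h {v}))"
    using assms by (intro dvd_sum) (auto simp: tjoin_def)
  moreover have "odd (card (odd_cut J h {t}))"
    using assms by (auto simp: tjoin_def)
  ultimately have "odd (card (odd_cut J h U))"
    using even_card_cut_iff[of J U h] assms by simp
  then show ?thesis by auto
qed

section \<open>Splitting off\<close>

text \<open>Two edges \<open>e\<close>, \<open>f\<close> with a common end are merged into the edge \<open>e\<close> joining their other ends;
  if these coincide, \<open>e\<close> is left with no ends at all.\<close>

definition merge_ends :: "'e \<Rightarrow> 'e \<Rightarrow> ('e \<Rightarrow> 'v set) \<Rightarrow> 'e \<Rightarrow> 'v set" where
  "merge_ends e f h = h(e := (h e - h f) \<union> (h f - h e))"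

lemma odd_card_sym_diff_Int:
  assumes "finite A" "finite B"
  shows "odd (card (((A - B) \<union> (B - A)) \<inter> U)) \<longleftrightarrow> odd (card (A \<inter> U)) \<noteq> odd (card (B \<inter> U))"
proof -
  have "card (A \<inter> U) = card ((A - B) \<inter> U) + card (A \<inter> B \<inter> U)"
    using assms by (subst card_Un_disjoint[symmetric]) (auto intro: arg_cong[where f = card])
  moreover have "card (B \<inter> U) = card ((B - A) \<inter> U) + card (A \<inter> B \<inter> U)"
    using assms by (subst card_Un_disjoint[symmetric]) (auto intro: arg_cong[where f = card])
  moreover have "card (((A - B) \<union> (B - A)) \<inter> U) = card ((A - B) \<inter> U) + card ((B - A) \<inter> U)"
    using assms by (subst card_Un_disjoint[symmetric]) (auto intro: arg_cong[where f = card])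
  ultimately show ?thesis by simp blast
qed

text \<open>The merged edge crosses \<open>U\<close> iff exactly one of \<open>e\<close>,
  \<open>f\<close> does. So a cut shrinks only when both cross it, and then by 2; in particular
  degrees keep their parity.\<close>

lemma card_cut_merge_ends:
  assumes "finite E" "e \<in> E" "f \<in> E" "e \<noteq> f" "finite (h e)" "finite (h f)"
  shows "card (odd_cut (E - {f}) (merge_ends e f h) U)
      + (if e \<in> odd_cut E h U \<and> f \<in> odd_cut E h U then 2 else 0) = card (odd_cut E h U)"
proof -
  let ?R = "E - {e, f}"
  have E: "E = insert e (insert f ?R)" and E': "E - {f} = insert e ?R"
    using assms by auto
  have R: "(\<Sum>g\<in>?R. of_bool (odd (card (merge_ends e f h g \<inter> U)))) =
      (\<Sum>g\<in>?R. of_bool (odd (card (h g \<inter> U))) :: nat)"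
    by (intro sum.cong) (auto simp: merge_ends_def)
  have m: "odd (card (merge_ends e f h e \<inter> U)) \<longleftrightarrow>
      odd (card (h e \<inter> U)) \<noteq> odd (card (h f \<inter> U))"
    using odd_card_sym_diff_Int[OF assms(5,6)] by (simp add: merge_ends_def)
  have 1: "card (odd_cut E h U) = of_bool (odd (card (h e \<inter> U))) + (of_bool (odd (card (h f \<inter> U)))
      + (\<Sum>g\<in>?R. of_bool (odd (card (h g \<inter> U)))))"
    unfolding card_cut[OF assms(1)] using assms by (subst E) simp
  have 2: "card (odd_cut (E - {f}) (merge_ends e f h) U) =
      of_bool (odd (card (h e \<inter> U)) \<noteq> odd (card (h f \<inter> U)))
      + (\<Sum>g\<in>?R. of_bool (odd (card (h g \<inter> U))))"
  proof -
    have fin: "finite ?R" and "e \<notin> ?R" using assms(1) by auto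
    then show ?thesis
      unfolding E' card_cut[OF finite.insertI[OF fin]]
      by (subst sum.insert) (assumption | rule refl arg_cong2[where f = "(+)"] arg_cong[where f = of_bool] m R)+
  qed
  have 3: "g \<in> odd_cut E h U \<longleftrightarrow> odd (card (h g \<inter> U))" if "g \<in> E" for g
    using that by (simp add: odd_cut_def)
  show ?thesis
    unfolding 1 2 3[OF assms(2)] 3[OF assms(3)]
    by (cases "odd (card (h e \<inter> U))"; cases "odd (card (h f \<inter> U))") simp_all
qed

text \<open>Lifting a join back: the merged edge is replaced by the two edges it came from, which
  changes every degree by 0 or 2.\<close>

lemma tjoin_split:
  assumes J: "tjoin (merge_ends e f h) T J" "finite J" "f \<notin> J"
    and ef: "e \<noteq> f" "finite (h e)" "finite (h f)"
  shows "tjoin h T (if e \<in> J then insert f J else J)"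
proof (cases "e \<in> J")
  case True
  have "card (odd_cut (insert f J) h {v}) = card (odd_cut J (merge_ends e f h) {v})
      + (if e \<in> odd_cut (insert f J) h {v} \<and> f \<in> odd_cut (insert f J) h {v} then 2 else 0)" for v
    using card_cut_merge_ends[of "insert f J" e f h "{v}"] True J ef by simp
  then have "even (card (odd_cut (insert f J) h {v})) \<longleftrightarrow> even (card (odd_cut J (merge_ends e f h) {v}))" for v
    by simp
  with J(1) True show ?thesis by (simp add: tjoin_def)
next
  case False
  then have "odd_cut J (merge_ends e f h) {v} = odd_cut J h {v}" for v
    by (auto simp: odd_cut_def merge_ends_def)
  with J(1) False show ?thesis by (simp add: tjoin_def)
qed

text \<open>Used to sum edgewise cut inequalities; a single surplus of 2 is kept, which is all that
  uncrossing needs.\<close>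

lemma sum_add_two_le:
  fixes f g :: "'a \<Rightarrow> nat"
  assumes "finite A" and le: "\<And>x. x \<in> A \<Longrightarrow> g x + (if Q x then 2 else 0) \<le> f x"
  shows "sum g A + (if \<exists>x\<in>A. Q x then 2 else 0) \<le> sum f A"
proof -
  have "(if \<exists>x\<in>A. Q x then 2 else 0) \<le> (\<Sum>x\<in>A. if Q x then 2 else 0 :: nat)"
  proof (cases "\<exists>x\<in>A. Q x")
    case True
    then obtain x where "x \<in> A" "Q x" by blast
    then show ?thesis
      using member_le_sum[of x A "\<lambda>x. if Q x then 2 else 0 :: nat"] assms(1) by auto
  qed simp
  moreover have "sum g A + (\<Sum>x\<in>A. if Q x then 2 else 0) \<le> sum f A"
    using le by (auto simp flip: sum.distrib intro: sum_mono)
  ultimately show ?thesis by linarith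
qed

locale inner_even_graph =
  fixes E :: "'e set" and h :: "'e \<Rightarrow> 'v set" and V T :: "'v set" and k :: nat
  assumes finite_V: "finite V" and finite_E: "finite E"
    and h_V: "e \<in> E \<Longrightarrow> h e \<subseteq> V"
    and h_card: "e \<in> E \<Longrightarrow> h e = {} \<or> card (h e) = 2"
    and even_inner: "y \<in> V - T \<Longrightarrow> even (card (odd_cut E h {y}))"
    and cut_ge: "U \<subseteq> V \<Longrightarrow> U \<inter> T = {t} \<Longrightarrow> k \<le> card (odd_cut E h U)"
begin

abbreviation d :: "'v set \<Rightarrow> nat" where "d U \<equiv> card (odd_cut E h U)"

definition side :: "'v \<Rightarrow> 'v set \<Rightarrow> bool" where
  "side t U \<longleftrightarrow> U \<subseteq> V \<and> U \<inter> T = {t}"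

text \<open>By parity, the tight sets on the side of \<open>t\<close> are exactly the minimum ones, provided the minimum
  is at most \<open>k + 1\<close>.\<close>

definition tight :: "'v \<Rightarrow> 'v set \<Rightarrow> bool" where
  "tight t U \<longleftrightarrow> side t U \<and> d U < k + 2"

lemma edge_cases:
  assumes "e \<in> E"
  obtains "h e = {}" | a b where "h e = {a, b}" "a \<noteq> b"
  using h_card[OF assms] by (auto simp: card_2_iff)

lemma edge_at:
  assumes "e \<in> E" "y \<in> h e"
  obtains a where "h e = {y, a}" "a \<noteq> y"
  using assms by (cases e rule: edge_cases) (auto simp: insert_commute)

text \<open>All vertices of \<open>U\<close> other than \<open>t\<close> are inner and have even
  degree, so only the degree of \<open>t\<close> counts modulo 2.\<close>

lemma side_parity:
  assumes "side t U"
  shows "even (d U) \<longleftrightarrow> even (d {t})"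
proof -
  have U: "finite U" "t \<in> U" "U - {t} \<subseteq> V - T"
    using assms finite_V by (auto simp: side_def intro: finite_subset)
  have "(\<Sum>v\<in>U. d {v}) = d {t} + (\<Sum>v\<in>U - {t}. d {v})"
    using U by (intro sum.remove)
  moreover have "even (\<Sum>v\<in>U - {t}. d {v})"
    using U even_inner by (intro dvd_sum) blast
  ultimately show ?thesis
    using even_card_cut_iff[OF finite_E U(1), of h] by simp
qed

lemma tight_le:
  assumes "tight t U" "side t W"
  shows "d U \<le> d W"
proof (rule ccontr)
  assume "\<not> ?thesis"
  moreover have "k \<le> d W" using assms cut_ge by (auto simp: side_def)
  \<comment> \<open>From \<open>k \<le> d W < d U < k + 2\<close> the two values differ by exactly
    1, against parity.\<close>
  ultimately have "d U = Suc (d W)" using assms by (auto simp: tight_def)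
  then show False using side_parity[of t U] side_parity[of t W] assms by (auto simp: tight_def)
qed

text \<open>Submodularity, checked edge by edge. An edge between \<open>A - B\<close> and
  \<open>B - A\<close> crosses both sets on the right and neither on the left, whence the
  surplus.\<close>

lemma d_Int_Un:
  "d (A \<inter> B) + d (A \<union> B) + (if \<exists>e\<in>E. \<exists>a\<in>A - B. \<exists>b\<in>B - A. h e = {a, b} then 2 else 0) \<le> d A + d B"
proof -
  have "of_bool (odd (card (h e \<inter> (A \<inter> B)))) + of_bool (odd (card (h e \<inter> (A \<union> B))))
      + (if \<exists>a\<in>A - B. \<exists>b\<in>B - A. h e = {a, b} then 2 else 0 :: nat)
      \<le> of_bool (odd (card (h e \<inter> A))) + of_bool (odd (card (h e \<inter> B)))" if "e \<in> E" for e
    using that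
  proof (cases e rule: edge_cases)
    case (2 a b)
    then have "odd (card (h e \<inter> W)) \<longleftrightarrow> (a \<in> W) \<noteq> (b \<in> W)" for W
      by (metis odd_card_pair_Int)
    then show ?thesis using 2 by (simp only:) (auto simp: doubleton_eq_iff)
  qed auto
  from sum_add_two_le[OF finite_E this] show ?thesis
    by (simp only: card_cut[OF finite_E] sum.distrib)
qed

text \<open>The companion inequality for differences (posimodularity); here the surplus comes from
  edges between \<open>A \<inter> B\<close> and the outside of \<open>A \<union> B\<close>.\<close>

lemma d_Diff:
  "d (A - B) + d (B - A) + (if \<exists>e\<in>E. \<exists>a\<in>A \<inter> B. \<exists>b\<in>-(A \<union> B). h e = {a, b} then 2 else 0) \<le> d A + d B"
proof -
  have "of_bool (odd (card (h e \<inter> (A - B)))) + of_bool (odd (card (h e \<inter> (B - A))))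
      + (if \<exists>a\<in>A \<inter> B. \<exists>b\<in>-(A \<union> B). h e = {a, b} then 2 else 0 :: nat)
      \<le> of_bool (odd (card (h e \<inter> A))) + of_bool (odd (card (h e \<inter> B)))" if "e \<in> E" for e
    using that
  proof (cases e rule: edge_cases)
    case (2 a b)
    then have "odd (card (h e \<inter> W)) \<longleftrightarrow> (a \<in> W) \<noteq> (b \<in> W)" for W
      by (metis odd_card_pair_Int)
    then show ?thesis using 2 by (simp only:) (auto simp: doubleton_eq_iff)
  qed auto
  from sum_add_two_le[OF finite_E this] show ?thesis
    by (simp only: card_cut[OF finite_E] sum.distrib)
qed

text \<open>Intersection and union stay on the side of \<open>t\<close>, where tight sets are
  minimum. Submodularity must then hold with equality, leaving no room for the surplus.\<close>

lemma tight_same_side: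
  assumes "tight t A" "tight t B"
  shows "tight t (A \<inter> B)" "tight t (A \<union> B)"
    and "e \<in> E \<Longrightarrow> a \<in> A - B \<Longrightarrow> b \<in> B - A \<Longrightarrow> h e \<noteq> {a, b}"
proof -
  have s: "side t (A \<inter> B)" "side t (A \<union> B)"
    using assms by (auto simp: tight_def side_def)
  have ge: "d A \<le> d (A \<inter> B)" "d B \<le> d (A \<union> B)" "d A \<le> d (A \<union> B)"  "d B \<le> d (A \<inter> B)"
    using s assms tight_le by blast+
  with d_Int_Un[of A B] have "d (A \<inter> B) \<le> d A" "d (A \<union> B) \<le> d B"
    and no: "\<not> (\<exists>e\<in>E. \<exists>a\<in>A - B. \<exists>b\<in>B - A. h e = {a, b})"
    by (auto split: if_splits)
  with s assms show "tight t (A \<inter> B)" "tight t (A \<union> B)"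
    by (auto simp: tight_def)
  show "e \<in> E \<Longrightarrow> a \<in> A - B \<Longrightarrow> b \<in> B - A \<Longrightarrow> h e \<noteq> {a, b}"
    using no by blast
qed

text \<open>For distinct terminals the differences keep \<open>s\<close> and \<open>t\<close> on
  their own sides, so the same argument runs with posimodularity.\<close>

lemma tight_other_side:
  assumes "tight s A" "tight t B" "s \<noteq> t"
  shows "tight s (A - B)"
    and "e \<in> E \<Longrightarrow> a \<in> A \<inter> B \<Longrightarrow> b \<notin> A \<union> B \<Longrightarrow> h e \<noteq> {a, b}"
proof -
  have s: "side s (A - B)" "side t (B - A)"
    using assms by (auto simp: tight_def side_def)
  have ge: "d A \<le> d (A - B)" "d B \<le> d (B - A)"
    using s assms tight_le by blast+
  with d_Diff[of A B] have "d (A - B) \<le> d A"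
    and no: "\<not> (\<exists>e\<in>E. \<exists>a\<in>A \<inter> B. \<exists>b\<in>-(A \<union> B). h e = {a, b})"
    by (auto split: if_splits)
  with s assms show "tight s (A - B)"
    by (auto simp: tight_def)
  show "e \<in> E \<Longrightarrow> a \<in> A \<inter> B \<Longrightarrow> b \<notin> A \<union> B \<Longrightarrow> h e \<noteq> {a, b}"
    using no by blast
qed

section \<open>Choosing two edges at an inner vertex that can be split off\<close>

lemma in_cut_iff:
  assumes "e \<in> E" "h e = {a, b}" "a \<noteq> b"
  shows "e \<in> odd_cut E h U \<longleftrightarrow> (a \<in> U) \<noteq> (b \<in> U)"
  unfolding odd_cut_def using assms odd_card_pair_Int[of a b U] by simp

text \<open>Sets that differ at most in \<open>y\<close> can be compared by looking only at the
  edges at \<open>y\<close>.\<close>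

lemma card_cut_less:
  assumes "U - {y} = W - {y}"
    and at: "\<And>e. e \<in> odd_cut E h W \<Longrightarrow> y \<in> h e \<Longrightarrow> e \<in> odd_cut E h U"
    and f: "f \<in> odd_cut E h U" "f \<notin> odd_cut E h W"
  shows "d W < d U"
proof (rule psubset_card_mono)
  have "e \<in> odd_cut E h U" if e: "e \<in> odd_cut E h W" "y \<notin> h e" for e
  proof -
    have "h e \<inter> U = h e \<inter> W" using e assms(1) by blast
    then show ?thesis using e by (simp add: odd_cut_def)
  qed
  then show "odd_cut E h W \<subset> odd_cut E h U" using at f by blast
qed (simp add: finite_E)

text \<open>Otherwise removing \<open>y\<close> from \<open>U\<close> would give a smaller cut on
  the same side.\<close>

lemma tight_inner_neighbour:
  assumes "tight t U" "y \<in> U" "y \<notin> T" "f \<in> E" "h f = {y, b}" "b \<notin> U"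
  obtains e a where "e \<in> E" "h e = {y, a}" "a \<in> U" "a \<noteq> y"
proof (rule ccontr)
  assume none: "\<not> thesis"
  have "d (U - {y}) < d U"
  proof (rule card_cut_less)
    fix e assume e: "e \<in> odd_cut E h (U - {y})" "y \<in> h e"
    then have "e \<in> E" by (auto simp: odd_cut_def)
    moreover from this obtain a where "h e = {y, a}" "a \<noteq> y" using e edge_at by blast
    ultimately show "e \<in> odd_cut E h U" using that none assms(2) in_cut_iff[of e y a U] by blast
  next
    have "y \<noteq> b" using assms(2,6) by auto
    note f = in_cut_iff[OF assms(4,5) this]
    show "f \<in> odd_cut E h U" "f \<notin> odd_cut E h (U - {y})"
      unfolding f using assms(2,6) by auto
  qed auto
  moreover have "side t (U - {y})" using assms by (auto simp: tight_def side_def)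
  ultimately show False using tight_le assms by fastforce
qed

text \<open>Otherwise adding \<open>y\<close> to \<open>U\<close> would give a smaller cut on the
  same side.\<close>

lemma tight_outer_neighbour:
  assumes "tight t U" "y \<notin> U" "y \<in> V - T" "f \<in> E" "h f = {y, b}" "b \<in> U"
  obtains e a where "e \<in> E" "h e = {y, a}" "a \<notin> U" "a \<noteq> y"
proof (rule ccontr)
  assume none: "\<not> thesis"
  have "d (insert y U) < d U"
  proof (rule card_cut_less)
    fix e assume e: "e \<in> odd_cut E h (insert y U)" "y \<in> h e"
    then have "e \<in> E" by (auto simp: odd_cut_def)
    moreover from this obtain a where "h e = {y, a}" "a \<noteq> y" using e edge_at by blast
    ultimately show "e \<in> odd_cut E h U" using that none assms(2) in_cut_iff[of e y a U] by blast
  next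
    have "y \<noteq> b" using assms(2,6) by auto
    note f = in_cut_iff[OF assms(4,5) this]
    show "f \<in> odd_cut E h U" "f \<notin> odd_cut E h (insert y U)"
      unfolding f using assms(2,6) by auto
  qed auto
  moreover have "side t (insert y U)" using assms by (auto simp: tight_def side_def)
  ultimately show False using tight_le assms by fastforce
qed

text \<open>Among the edges at \<open>y\<close>, pair the given one with an edge staying inside a smallest tight set around
  \<open>y\<close>: any tight set cut by both edges would cross that set.\<close>

lemma splittable_pair_leaving:
  assumes y: "y \<in> V - T" and U0: "tight t U0" "y \<in> U0"
    and f: "f \<in> E" "h f = {y, b}" "b \<notin> U0"
  shows "\<exists>e\<in>E. e \<noteq> f \<and> y \<in> h e \<and> (\<forall>s X. tight s X \<longrightarrow> e \<notin> odd_cut E h X \<or> f \<notin> odd_cut E h X)"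
proof -
  define U where "U = (ARG_MIN card U. tight t U \<and> y \<in> U)"
  have U: "tight t U" "y \<in> U" and U_least: "\<And>W. tight t W \<Longrightarrow> y \<in> W \<Longrightarrow> card U \<le> card W"
    unfolding U_def using arg_min_nat_lemma[of "\<lambda>U. tight t U \<and> y \<in> U" U0 card] U0 by blast+
  have finU: "finite U" using U finite_V by (auto simp: tight_def side_def intro: finite_subset)
  \<comment> \<open>Tight sets of \<open>t\<close> are closed under intersection, so least
    cardinality gives least by inclusion.\<close>
  have U_min: "U \<subseteq> W" if "tight t W" "y \<in> W" for W
  proof -
    have "card U \<le> card (U \<inter> W)" using that U U_least tight_same_side(1) by blast
    then show ?thesis using finU by (metis Int_lower1 card_seteq inf.absorb_iff1)
  qed
  have b: "b \<notin> U" "b \<noteq> y" using U_min U0 f by auto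
  obtain e a where e: "e \<in> E" "h e = {y, a}" "a \<in> U" "a \<noteq> y"
    using tight_inner_neighbour[OF U _ f(1,2) b(1)] y by blast
  have "e \<notin> odd_cut E h X \<or> f \<notin> odd_cut E h X" if X: "tight s X" for s X
  proof (rule ccontr)
    assume "\<not> ?thesis"
    then have c: "(y \<in> X) \<noteq> (a \<in> X)" "(y \<in> X) \<noteq> (b \<in> X)"
      using in_cut_iff[OF e(1,2)] in_cut_iff[OF f(1,2)] e b by auto
    \<comment> \<open>If \<open>y \<in> X\<close> and \<open>s = t\<close>, or neither holds,
      minimality puts \<open>U\<close> inside \<open>X\<close> or \<open>U - X\<close>, which
      \<open>a\<close> refutes. In the mixed cases \<open>f\<close> is an edge forbidden by
      uncrossing.\<close>
    show False
    proof (cases "y \<in> X"; cases "s = t")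
      assume "y \<in> X" "s = t"
      then show False using U_min X c e by auto
    next
      assume "y \<in> X" "s \<noteq> t"
      then show False using tight_other_side(2)[OF X U(1) _ f(1), of y b] f c U b by auto
    next
      assume "y \<notin> X" "s = t"
      then show False using tight_same_side(3)[OF U(1) _ f(1), of X y b] X f c U b by auto
    next
      assume "y \<notin> X" "s \<noteq> t"
      then have "U \<subseteq> U - X" using tight_other_side(1)[OF U(1) X] U_min U by auto
      then show False using e c \<open>y \<notin> X\<close> by auto
    qed
  qed
  then show ?thesis using e f b by (intro bexI[of _ e]) auto
qed

text \<open>Here only tight sets avoiding \<open>y\<close> can obstruct, and those containing the other end of \<open>e\<close> all belong
  to the same terminal, so it suffices to leave a largest one.\<close>

lemma splittable_pair_not_leaving:
  assumes y: "y \<in> V - T" and e: "e \<in> E" "y \<in> h e"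
    and closed: "\<And>t U f. tight t U \<Longrightarrow> y \<in> U \<Longrightarrow> f \<in> E \<Longrightarrow> y \<in> h f \<Longrightarrow> h f \<subseteq> U"
  shows "\<exists>f\<in>E. e \<noteq> f \<and> y \<in> h f \<and> (\<forall>s X. tight s X \<longrightarrow> e \<notin> odd_cut E h X \<or> f \<notin> odd_cut E h X)"
proof -
  obtain a where a: "h e = {y, a}" "a \<noteq> y" using e edge_at by blast
  \<comment> \<open>A tight set containing \<open>y\<close> contains every edge at \<open>y\<close>,
    so one cut by such an edge contains just its other end.\<close>
  have sep: "y \<notin> X \<and> b \<in> X" if "tight s X" "f \<in> E" "h f = {y, b}" "b \<noteq> y" "f \<in> odd_cut E h X" for s X f b
    using that in_cut_iff[of f y b X] closed[of s X f] by auto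
  show ?thesis
  proof (cases "\<exists>t N. tight t N \<and> y \<notin> N \<and> a \<in> N")
    case False
    \<comment> \<open>Here no tight set is cut by \<open>e\<close>, so any second edge will do; it
      exists because \<open>y\<close> has even degree.\<close>
    obtain f where f: "f \<in> E" "f \<noteq> e" "y \<in> h f"
    proof (rule ccontr)
      assume "\<not> thesis"
      with that e have "odd_cut E h {y} = {e}" by (auto simp: cut_singleton)
      then show False using even_inner[OF y] by simp
    qed
    show ?thesis using f e False sep[OF _ e(1) a] by (intro bexI[of _ f]) auto
  next
    case True
    then obtain t N0 where N0: "tight t N0" "y \<notin> N0" "a \<in> N0" by blast
    define P where "P N \<longleftrightarrow> tight t N \<and> y \<notin> N" for N
    \<comment> \<open>\<open>ARG_MAX\<close> on \<open>nat\<close> attains a maximum only given an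
      upper bound, here a strict one.\<close>
    have bound: "card W < Suc (card V)" if "P W" for W
      using that finite_V by (auto simp: P_def tight_def side_def less_Suc_eq_le intro: card_mono)
    define N where "N = (ARG_MAX card N. P N)"
    have P0: "P N0" using N0 by (simp add: P_def)
    have N: "P N" and N_greatest: "\<And>W. P W \<Longrightarrow> card W \<le> card N"
      unfolding N_def using arg_max_nat_lemma[of P N0 card "Suc (card V)"] P0 bound by blast+
    have N_max: "W \<subseteq> N" if "P W" for W
    proof -
      have PU: "P (N \<union> W)" using that N tight_same_side(2) by (auto simp: P_def)
      then have "finite (N \<union> W)" using finite_V by (auto simp: P_def tight_def side_def intro: finite_subset)
      then show ?thesis using N_greatest[OF PU] by (metis Un_upper1 card_seteq sup.absorb_iff1)
    qed
    have aN: "a \<in> N" using N_max[OF P0] N0 by auto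
    obtain f b where f: "f \<in> E" "h f = {y, b}" "b \<notin> N" "b \<noteq> y"
      using tight_outer_neighbour[of t N y e a] N y e a aN by (auto simp: P_def)
    have "e \<notin> odd_cut E h X \<or> f \<notin> odd_cut E h X" if X: "tight s X" for s X
    proof (rule ccontr)
      assume "\<not> ?thesis"
      then have c: "y \<notin> X" "a \<in> X" "b \<in> X"
        using sep[OF X e(1) a] sep[OF X f(1,2,4)] by auto
      \<comment> \<open>Otherwise \<open>e\<close> would join \<open>a\<close>, in both
        \<open>X\<close> and \<open>N\<close>, to \<open>y\<close>, in neither. With
        \<open>s = t\<close>, maximality gives \<open>X \<subseteq> N\<close>, yet \<open>b\<close>
        lies in \<open>X\<close> and not in \<open>N\<close>.\<close>
      have "s = t"
      proof (rule ccontr)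
        assume "s \<noteq> t"
        then show False
          using tight_other_side(2)[OF X _ _ e(1), of t N a y] N c a aN by (auto simp: P_def insert_commute)
      qed
      then have "P X" using X c by (simp add: P_def)
      then show False using N_max c f by auto
    qed
    then show ?thesis using f a aN by (intro bexI[of _ f]) auto
  qed
qed

text \<open>Pairs not cut together by any tight set are those whose merging keeps the cut
  condition.\<close>

lemma splittable_pair:
  assumes y: "y \<in> V - T" and deg: "odd_cut E h {y} \<noteq> {}"
  shows "\<exists>e\<in>E. \<exists>f\<in>E. e \<noteq> f \<and> y \<in> h e \<and> y \<in> h f \<and>
    (\<forall>s X. tight s X \<longrightarrow> e \<notin> odd_cut E h X \<or> f \<notin> odd_cut E h X)"
proof (cases "\<exists>t U f. tight t U \<and> y \<in> U \<and> f \<in> E \<and> y \<in> h f \<and> \<not> h f \<subseteq> U")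
  case True
  then obtain t U f where f: "tight t U" "y \<in> U" "f \<in> E" "y \<in> h f" "\<not> h f \<subseteq> U" by blast
  obtain b where "h f = {y, b}" using f edge_at by blast
  with f splittable_pair_leaving[OF y f(1,2,3), of b] show ?thesis by auto
next
  case False
  obtain e where "e \<in> E" "y \<in> h e" using deg by (auto simp: cut_singleton)
  with False splittable_pair_not_leaving[OF y this] show ?thesis by blast
qed

text \<open>A cut shrinks only if both edges cross it; the set is then not tight, so on a side of a
  terminal it has at least \<open>k + 2\<close> edges and can spare two.\<close>

lemma inner_even_graph_merge_ends:
  assumes ef: "e \<in> E" "f \<in> E" "e \<noteq> f" "y \<in> h e" "y \<in> h f"
    and ok: "\<forall>s X. tight s X \<longrightarrow> e \<notin> odd_cut E h X \<or> f \<notin> odd_cut E h X"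
  shows "inner_even_graph (E - {f}) (merge_ends e f h) V T k"
proof
  obtain a b where ab: "h e = {y, a}" "a \<noteq> y" "h f = {y, b}" "b \<noteq> y"
    using ef edge_at by metis
  note m = card_cut_merge_ends[OF finite_E ef(1,2,3), of h]
  show "finite V" "finite (E - {f})" using finite_V finite_E by auto
  show "merge_ends e f h g \<subseteq> V" if "g \<in> E - {f}" for g
    using that h_V[of g] h_V[of f] ef by (auto simp: merge_ends_def)
  show "merge_ends e f h g = {} \<or> card (merge_ends e f h g) = 2" if "g \<in> E - {f}" for g
  proof (cases "g = e")
    case True
    then have "merge_ends e f h g = (if a = b then {} else {a, b})"
      using ab by (auto simp: merge_ends_def)
    then show ?thesis by auto
  next
    case False
    then show ?thesis using that h_card[of g] by (auto simp: merge_ends_def)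
  qed
  show "even (card (odd_cut (E - {f}) (merge_ends e f h) {v}))" if "v \<in> V - T" for v
    using m[of "{v}", symmetric] even_inner[OF that] ab by simp
  show "k \<le> card (odd_cut (E - {f}) (merge_ends e f h) U)" if "U \<subseteq> V" "U \<inter> T = {t}" for U t
  proof (cases "e \<in> odd_cut E h U \<and> f \<in> odd_cut E h U")
    case True
    then have "\<not> tight t U" using ok by blast
    then have "k + 2 \<le> d U" using that by (auto simp: tight_def side_def)
    then show ?thesis using m[of U] True ab by auto
  next
    case False
    then show ?thesis using m[of U] ab cut_ge[OF that] by auto
  qed
qed

end

section \<open>Four vertices\<close>

lemma tjoin_matching:
  assumes "e \<noteq> f" "h e \<inter> h f = {}" "h e \<union> h f = T"
  shows "tjoin h T {e, f}"
proof -
  have "odd_cut {e, f} h {v} = (if v \<in> h e then {e} else if v \<in> h f then {f} else {})" for v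
    using assms by (auto simp: cut_singleton)
  then show ?thesis using assms by (auto simp: tjoin_def)
qed

lemma tjoin_star:
  assumes "distinct [c, p, q, r]" "h e = {c, p}" "h f = {c, q}" "h g = {c, r}"
  shows "tjoin h {c, p, q, r} {e, f, g}"
proof -
  have "e \<noteq> f" "e \<noteq> g" "f \<noteq> g" using assms by (auto simp: doubleton_eq_iff)
  moreover have "odd_cut {e, f, g} h {v} = (if v = c then {e, f, g} else if v = p then {e}
      else if v = q then {f} else if v = r then {g} else {})" for v
    using assms by (auto simp: cut_singleton)
  ultimately show ?thesis by (auto simp: tjoin_def)
qed

lemma card_cut_Diff_ge:
  assumes "finite E" "Suc k \<le> card (odd_cut E h U)" "odd_cut J h U \<subseteq> {e}"
  shows "k \<le> card (odd_cut (E - J) h U)"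
proof -
  have "odd_cut (E - J) h U = odd_cut E h U - odd_cut J h U" by (auto simp: odd_cut_def)
  then have "odd_cut E h U - {e} \<subseteq> odd_cut (E - J) h U" using assms by auto
  then have "card (odd_cut E h U - {e}) \<le> card (odd_cut (E - J) h U)"
    using assms by (intro card_mono) auto
  then show ?thesis using assms by (simp add: card_Diff_singleton_if split: if_splits)
qed

text \<open>Pairwise meeting pairs form a star or a triangle, and a triangle misses one of four
  points. Concretely, edges at the two points off \<open>{t, s}\<close> must meet
  \<open>{t, s}\<close> and each other, so they share an end: the centre.\<close>

lemma intersecting_pairs_star:
  assumes "card T = 4" and ET: "\<And>e. e \<in> E \<Longrightarrow> h e \<subseteq> T \<and> (h e = {} \<or> card (h e) = 2)"
    and cover: "\<And>t. t \<in> T \<Longrightarrow> \<exists>e\<in>E. t \<in> h e"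
    and meet: "\<And>e f. e \<in> E \<Longrightarrow> f \<in> E \<Longrightarrow> h e \<noteq> {} \<Longrightarrow> h f \<noteq> {} \<Longrightarrow> h e \<inter> h f \<noteq> {}"
  obtains c p q r e f g where "distinct [c, p, q, r]" "T = {c, p, q, r}" "e \<in> E" "f \<in> E" "g \<in> E"
    "h e = {c, p}" "h f = {c, q}" "h g = {c, r}"
proof -
  have pair: "\<exists>b. h e = {t, b} \<and> b \<noteq> t \<and> b \<in> T" if "e \<in> E" "t \<in> h e" for e t
    using ET[OF that(1)] that by (auto simp: card_2_iff)
  obtain t where "t \<in> T" using assms(1) by fastforce
  then obtain e s where e: "e \<in> E" "h e = {t, s}" "s \<noteq> t" "s \<in> T" using cover pair by metis
  have fT: "finite T" using assms(1) card.infinite by fastforce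
  have "card (T - {t, s}) = 2"
    using assms(1) e \<open>t \<in> T\<close> fT by (subst card_Diff_subset) auto
  then obtain q r where qr: "T - {t, s} = {q, r}" "q \<noteq> r" by (auto simp: card_2_iff)
  then have qrT: "q \<in> T" "r \<in> T" "q \<notin> {t, s}" "r \<notin> {t, s}" and T: "T = {t, s, q, r}"
    using e \<open>t \<in> T\<close> by auto
  obtain f b where f: "f \<in> E" "h f = {q, b}" "b \<noteq> q" using cover pair qrT by metis
  obtain g b' where g: "g \<in> E" "h g = {r, b'}" "b' \<noteq> r" using cover pair qrT by metis
  have b: "b \<in> {t, s}" "b' \<in> {t, s}"
    using meet[OF e(1) f(1)] meet[OF e(1) g(1)] e f g qrT by auto
  then have "b = b'" using meet[OF f(1) g(1)] f g qr qrT by auto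
  show thesis
  proof (cases "b = t")
    case True
    then show thesis using that[of t s q r e f g] e f g qr qrT T \<open>b = b'\<close> by (auto simp: insert_commute)
  next
    case False
    then show thesis using that[of s t q r e f g] e f g qr qrT T b \<open>b = b'\<close> by (auto simp: insert_commute)
  qed
qed

lemma four_vertex_tjoin:
  assumes fin: "finite E" and T: "card T = 4"
    and ET: "\<And>e. e \<in> E \<Longrightarrow> h e \<subseteq> T \<and> (h e = {} \<or> card (h e) = 2)"
    and deg: "\<And>t. t \<in> T \<Longrightarrow> Suc k \<le> card (odd_cut E h {t})"
  obtains J where "J \<subseteq> E" "tjoin h T J" "\<And>t. t \<in> T \<Longrightarrow> k \<le> card (odd_cut (E - J) h {t})"
proof (cases "\<exists>e\<in>E. \<exists>f\<in>E. h e \<noteq> {} \<and> h f \<noteq> {} \<and> h e \<inter> h f = {}")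
  case True
  then obtain e f where ef: "e \<in> E" "f \<in> E" "h e \<noteq> {}" "h f \<noteq> {}" "h e \<inter> h f = {}" by blast
  have c: "card (h e) = 2" "card (h f) = 2" and sub: "h e \<union> h f \<subseteq> T" using ET ef by auto
  have "card (h e \<union> h f) = 4"
    using c ef by (subst card_Un_disjoint) (auto intro: card_ge_0_finite)
  then have u: "h e \<union> h f = T"
    using sub T by (intro card_subset_eq) (auto intro: card_ge_0_finite)
  show thesis
  proof (rule that)
    show "{e, f} \<subseteq> E" using ef by auto
    show "tjoin h T {e, f}" using ef u by (intro tjoin_matching) auto
    fix t assume "t \<in> T"
    moreover have "odd_cut {e, f} h {t} \<subseteq> {if t \<in> h e then e else f}"
      using ef by (auto simp: cut_singleton)
    ultimately show "k \<le> card (odd_cut (E - {e, f}) h {t})"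
      by (intro card_cut_Diff_ge[OF fin deg])
  qed
next
  case False
  have cover: "\<exists>e\<in>E. t \<in> h e" if "t \<in> T" for t
  proof -
    have "odd_cut E h {t} \<noteq> {}" using deg[OF that] by auto
    then show ?thesis by (auto simp: cut_singleton)
  qed
  have meet: "h e \<inter> h f \<noteq> {}" if "e \<in> E" "f \<in> E" "h e \<noteq> {}" "h f \<noteq> {}" for e f
    using False that by blast
  obtain c p q r e f g where S: "distinct [c, p, q, r]" "T = {c, p, q, r}" "e \<in> E" "f \<in> E" "g \<in> E"
    "h e = {c, p}" "h f = {c, q}" "h g = {c, r}"
    by (rule intersecting_pairs_star[OF T ET cover meet]; blast)
  \<comment> \<open>An edge avoiding \<open>c\<close> could meet all three star edges only by
    containing all three leaves.\<close>
  have centre: "c \<in> h x" if x: "x \<in> E" "h x \<noteq> {}" for x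
  proof (rule ccontr)
    assume "c \<notin> h x"
    then have "{p, q, r} \<subseteq> h x"
      using meet[OF x(1) S(3)] meet[OF x(1) S(4)] meet[OF x(1) S(5)] x S by auto
    then have "card {p, q, r} \<le> card (h x)"
      using x ET[OF x(1)] by (intro card_mono) (auto intro: card_ge_0_finite)
    then show False using S x ET[OF x(1)] by auto
  qed
  let ?J = "{e, f, g}"
  have leaf: "k \<le> card (odd_cut (E - ?J) h {t})" if "t \<in> T" "t \<noteq> c" for t
  proof -
    have "odd_cut ?J h {t} \<subseteq> {if t = p then e else if t = q then f else g}"
      using that S by (auto simp: cut_singleton)
    then show ?thesis using that by (intro card_cut_Diff_ge[OF fin deg])
  qed
  show thesis
  proof (rule that)
    show "?J \<subseteq> E" using S by auto
    show "tjoin h T ?J" unfolding S(2) using S by (intro tjoin_star)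
    fix t assume t: "t \<in> T"
    \<comment> \<open>The centre loses three edges, but each remaining edge at the leaf
      \<open>p\<close> also contains \<open>c\<close>, so the bound for \<open>p\<close> carries
      over.\<close>
    have "odd_cut (E - ?J) h {p} \<subseteq> odd_cut (E - ?J) h {c}"
      using centre by (auto simp: cut_singleton)
    then have "card (odd_cut (E - ?J) h {p}) \<le> card (odd_cut (E - ?J) h {c})"
      using fin by (intro card_mono) auto
    then show "k \<le> card (odd_cut (E - ?J) h {t})"
      using leaf[of t] leaf[of p] t S by (cases "t = c") auto
  qed
qed

text \<open>With all edges inside \<open>T\<close>, a set meeting \<open>T\<close> only in
  \<open>t\<close> has the same cut as \<open>{t}\<close>, so degree bounds alone carry the
  induction.\<close>

lemma four_vertex_packing:
  assumes "finite E" and T: "card T = 4"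
    and "\<And>e. e \<in> E \<Longrightarrow> h e \<subseteq> T \<and> (h e = {} \<or> card (h e) = 2)"
    and "\<And>t. t \<in> T \<Longrightarrow> k \<le> card (odd_cut E h {t})"
  shows "\<exists>P :: nat \<Rightarrow> 'e set. (\<forall>i<k. P i \<subseteq> E \<and> tjoin h T (P i)) \<and> disjoint_family_on P {..<k}"
  using assms(1,3,4)
proof (induction k arbitrary: E)
  case 0
  then show ?case by (auto simp: disjoint_family_on_def)
next
  case (Suc k)
  obtain J where J: "J \<subseteq> E" "tjoin h T J" "\<And>t. t \<in> T \<Longrightarrow> k \<le> card (odd_cut (E - J) h {t})"
    using four_vertex_tjoin[OF Suc.prems(1) T Suc.prems(2,3)] by metis
  obtain P :: "nat \<Rightarrow> 'e set" where P: "\<forall>i<k. P i \<subseteq> E - J \<and> tjoin h T (P i)" "disjoint_family_on P {..<k}"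
    using Suc.IH[of "E - J"] Suc.prems J(3) by auto
  show ?case
  proof (intro exI conjI)
    show "\<forall>i<Suc k. (P(k := J)) i \<subseteq> E \<and> tjoin h T ((P(k := J)) i)"
      using P J by (auto simp: less_Suc_eq)
    show "disjoint_family_on (P(k := J)) {..<Suc k}"
      using P unfolding disjoint_family_on_def by (auto simp: less_Suc_eq) blast+
  qed
qed

section \<open>Packing\<close>

text \<open>Induction on the number of edges, since each splitting removes \<open>f\<close>.\<close>

lemma inner_even_graph_packing:
  assumes "inner_even_graph E h V T k" "T \<subseteq> V" "card T = 4"
  shows "\<exists>P :: nat \<Rightarrow> 'e set. (\<forall>i<k. P i \<subseteq> E \<and> tjoin h T (P i)) \<and> disjoint_family_on P {..<k}"
  using assms(1)
proof (induction "card E" arbitrary: E h rule: less_induct)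
  case less
  interpret inner_even_graph E h V T k by (rule less.prems)
  show ?case
  proof (cases "\<exists>y\<in>V - T. odd_cut E h {y} \<noteq> {}")
    case True
    then obtain y e f where y: "e \<in> E" "f \<in> E" "e \<noteq> f" "y \<in> h e" "y \<in> h f"
      "\<forall>s X. tight s X \<longrightarrow> e \<notin> odd_cut E h X \<or> f \<notin> odd_cut E h X"
      using splittable_pair by metis
    have fin: "finite (h e)" "finite (h f)"
      using h_V y finite_V by (auto intro: finite_subset)
    have "card (E - {f}) < card E"
      using y finite_E by (intro psubset_card_mono) auto
    from less.hyps[OF this inner_even_graph_merge_ends[OF y]]
    obtain P :: "nat \<Rightarrow> 'e set" where
      P: "\<forall>i<k. P i \<subseteq> E - {f} \<and> tjoin (merge_ends e f h) T (P i)" "disjoint_family_on P {..<k}"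
      by (elim exE conjE)
    \<comment> \<open>By disjointness at most one \<open>P i\<close> contains the merged edge
      \<open>e\<close>, so \<open>f\<close> is put back at most once and the family stays
      disjoint.\<close>
    let ?Q = "\<lambda>i. if e \<in> P i then insert f (P i) else P i"
    have "tjoin h T (?Q i)" if "i < k" for i
      using P(1) that y(3) fin finite_subset[OF _ finite_E, of "P i"] by (intro tjoin_split) auto
    moreover have "?Q i \<subseteq> E" if "i < k" for i
      using P(1) that y(2) by auto
    moreover have "disjoint_family_on ?Q {..<k}"
      unfolding disjoint_family_on_def
    proof (intro ballI impI)
      fix i j assume ij: "i \<in> {..<k}" "j \<in> {..<k}" "i \<noteq> j"
      then have "P i \<inter> P j = {}" "f \<notin> P i" "f \<notin> P j"
        using P by (simp_all add: disjoint_family_on_def) blast+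
      then show "?Q i \<inter> ?Q j = {}" by auto
    qed
    ultimately show ?thesis by (intro exI[of _ ?Q] conjI allI impI)
  next
    case False
    show ?thesis
    proof (rule four_vertex_packing[OF finite_E assms(3)])
      show "h e \<subseteq> T \<and> (h e = {} \<or> card (h e) = 2)" if e: "e \<in> E" for e
      proof
        show "h e \<subseteq> T"
          using False h_V[OF e] e unfolding cut_singleton by blast
      qed (rule h_card[OF e])
      show "k \<le> card (odd_cut E h {t})" if "t \<in> T" for t
      proof (rule cut_ge)
        show "{t} \<subseteq> V" "{t} \<inter> T = {t}" using that assms(2) by blast+
      qed
    qed
  qed
qed

section \<open>Chains\<close>

lemma lookup_generator_sum:
  assumes "finite A"
  shows "Poly_Mapping.lookup (\<Sum>x\<in>A. generator x) v = of_bool (v \<in> A)"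
  using assms by (simp add: lookup_sum lookup_single when_def)

lemma keys_generator_sum: "finite A \<Longrightarrow> Poly_Mapping.keys (\<Sum>x\<in>A. generator x) = A"
  by (auto simp: in_keys_iff lookup_generator_sum)

text \<open>The coefficient of the boundary at \<open>v\<close> is the degree of \<open>v\<close> in
  the support, modulo 2.\<close>

lemma boundary_eq_iff_tjoin:
  assumes "\<And>e. e \<in> Poly_Mapping.keys p \<Longrightarrow> finite (ends G e)" "finite T"
  shows "boundary G p = (\<Sum>t\<in>T. generator t) \<longleftrightarrow> tjoin (ends G) T (Poly_Mapping.keys p)"
proof -
  have "Poly_Mapping.lookup (boundary G p) v = of_bool (odd (card (odd_cut (Poly_Mapping.keys p) (ends G) {v})))" for v
  proof -
    have "Poly_Mapping.lookup (boundary G p) v = (\<Sum>e\<in>Poly_Mapping.keys p. of_bool (v \<in> ends G e))"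
      unfolding boundary_def lookup_sum[of _ "Poly_Mapping.keys p"]
      by (intro sum.cong refl lookup_generator_sum assms)
    also have "\<dots> = of_nat (card (odd_cut (Poly_Mapping.keys p) (ends G) {v}))"
      by (simp add: cut_singleton of_bool_def sum.If_cases Int_def)
    also have "\<dots> = of_bool (odd (card (odd_cut (Poly_Mapping.keys p) (ends G) {v})))"
      by (cases "even (card (odd_cut (Poly_Mapping.keys p) (ends G) {v}))") (auto elim!: evenE oddE)
    finally show ?thesis .
  qed
  then show ?thesis
    using assms(2) by (auto simp: poly_mapping_eq_iff fun_eq_iff lookup_generator_sum tjoin_def)
qed

theorem theorem2p9:
  fixes G :: "('v, 'e) multigraph"
    and v1 v2 v3 v4 :: 'v and Y :: "'v set" and k :: nat
  assumes "k > 0"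
    and "finite_multigraph G"
    and "distinct [v1, v2, v3, v4]"
    and "verts G = {v1, v2, v3, v4} \<union> Y"
    and "{v1, v2, v3, v4} \<inter> Y = {}"
    and "\<forall>y\<in>Y. even (vertex_degree G y)"
    and "\<forall>F. F \<subseteq> edges G \<and> card F \<le> k - 1 \<longrightarrow>
           (\<exists>p \<in> formal_sums (edges (delete_edges G F)).
              boundary (delete_edges G F) p
                = generator v1 + generator v2 + generator v3 + generator v4)"
  shows "\<exists>p :: nat \<Rightarrow> ('e \<Rightarrow>\<^sub>0 bit).
           (\<forall>i\<in>{1..k}. p i \<in> formal_sums (edges G)) \<and>
           (\<forall>i\<in>{1..k}. \<forall>j\<in>{1..k}. i \<noteq> j \<longrightarrow> no_common_summand (p i) (p j)) \<and>
           (\<forall>i\<in>{1..k}. boundary G (p i)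
              = generator v1 + generator v2 + generator v3 + generator v4)"
proof -
  interpret finite_multigraph G by (rule assms(2))
  define T where "T = {v1, v2, v3, v4}"
  have T: "finite T" "card T = 4" "T \<subseteq> verts G" and Y: "verts G - T = Y"
    and sum_T: "generator v1 + generator v2 + generator v3 + generator v4 = (\<Sum>t\<in>T. generator t)"
    using assms(3-5) by (auto simp: T_def add.assoc)
  have fin_ends: "finite (ends G e)" if "e \<in> edges G" for e
    using card_ends[OF that] by (intro card_ge_0_finite) simp
  have "inner_even_graph (edges G) (ends G) (verts G) T k"
  proof
    show "finite (verts G)" "finite (edges G)" by (rule finite_verts finite_edges)+
    show "ends G e \<subseteq> verts G" "ends G e = {} \<or> card (ends G e) = 2" if "e \<in> edges G" for e
      using ends_subset card_ends that by auto
    show "even (card (odd_cut (edges G) (ends G) {y}))" if "y \<in> verts G - T" for y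
      using assms(6) that unfolding Y by (simp add: cut_singleton vertex_degree_def)
    show "k \<le> card (odd_cut (edges G) (ends G) U)" if U: "U \<subseteq> verts G" "U \<inter> T = {t}" for U t
    proof (rule ccontr)
      \<comment> \<open>The cut itself is deleted: the support of a surviving chain is a join, hence
        crosses \<open>U\<close>, yet it avoids every edge of the cut.\<close>
      let ?F = "odd_cut (edges G) (ends G) U"
      assume "\<not> k \<le> card ?F"
      then have "?F \<subseteq> edges G \<and> card ?F \<le> k - 1" by (auto simp: odd_cut_def)
      then obtain p where p: "p \<in> formal_sums (edges (delete_edges G ?F))"
        "boundary (delete_edges G ?F) p = (\<Sum>t\<in>T. generator t)"
        using assms(7)[unfolded sum_T] by blast
      have keys: "Poly_Mapping.keys p \<subseteq> edges G - ?F"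
        using p(1) by (simp add: formal_sums_def delete_edges_def)
      have "boundary G p = (\<Sum>t\<in>T. generator t)"
        using p(2) by (simp add: boundary_def delete_edges_def)
      then have "tjoin (ends G) T (Poly_Mapping.keys p)"
        using boundary_eq_iff_tjoin[of p G T] keys fin_ends T by blast
      then have "odd_cut (Poly_Mapping.keys p) (ends G) U \<noteq> {}"
        using U finite_verts by (intro tjoin_cut_nonempty) (auto intro: finite_subset)
      then show False using keys by (auto simp: odd_cut_def)
    qed
  qed
  from inner_even_graph_packing[OF this T(3,2)]
  obtain P :: "nat \<Rightarrow> 'e set" where P: "\<forall>i<k. P i \<subseteq> edges G \<and> tjoin (ends G) T (P i)"
    "disjoint_family_on P {..<k}"
    by (elim exE conjE)
  \<comment> \<open>The packing is indexed from 0 and the chains from 1; the shift is injective on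
    \<open>{1..k}\<close>.\<close>
  let ?p = "\<lambda>i. \<Sum>e\<in>P (i - 1). generator e"
  have less: "i - 1 < k" if "i \<in> {1..k}" for i using that by auto
  have keys: "Poly_Mapping.keys (?p i) = P (i - 1)" if "i \<in> {1..k}" for i
    using P(1) less[OF that] finite_edges by (intro keys_generator_sum) (blast intro: finite_subset)
  show ?thesis
    unfolding sum_T
  proof (intro exI[of _ ?p] conjI ballI impI)
    fix i assume i: "i \<in> {1..k}"
    show "?p i \<in> formal_sums (edges G)"
      unfolding formal_sums_def mem_Collect_eq keys[OF i] using P(1) less[OF i] by blast
    have "tjoin (ends G) T (Poly_Mapping.keys (?p i))"
      unfolding keys[OF i] using P(1) less[OF i] by blast
    moreover have "Poly_Mapping.keys (?p i) \<subseteq> edges G"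
      unfolding keys[OF i] using P(1) less[OF i] by blast
    ultimately show "boundary G (?p i) = (\<Sum>t\<in>T. generator t)"
      using boundary_eq_iff_tjoin[of "?p i" G T] T(1) fin_ends by blast
    fix j assume j: "j \<in> {1..k}" and "i \<noteq> j"
    then have "i - 1 \<noteq> j - 1" using i by auto
    then show "no_common_summand (?p i) (?p j)"
      unfolding no_common_summand_def keys[OF i] keys[OF j]
      using P(2) less[OF i] less[OF j] by (simp add: disjoint_family_on_def)
  qed
qed

end
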